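(* Let $\mathbb{F}_q$ be a finite field with $q$ elements, let $\Psi:\mathbb{F}_q\to\mathbb{C}$ be a nontrivial additive character, let $k\ge 1$ be an integer, let $\alpha_1,\dots,\alpha_{2k-1}\in\widehat{\mathbb{F}_q^\times}$, and let $t\in\mathbb{F}_q^\times$. Put $n=2k-1$, $N=2k$, and $A=\{\mathbf{a}_1,\dots,\mathbf{a}_{2k}\}$ in $(\mathbb{Z}/(q-1)\mathbb{Z})^{2k-1}$, where $\mathbf{a}_1,\dots,\mathbf{a}_{2k-1}$ are the standard unit basis vectors and $\mathbf{a}_{2k}=(1,\dots,1,-1,\dots,-1)$ ($1$ repeated $k$ times followed by $-1$ repeated $k-1$ times), and put $\beta=(\bar\alpha_1,\dots,\bar\alpha_k,\alpha_{k+1},\dots,\alpha_{2k-1})$. Let $$C=\prod_{i=1}^k g(\alpha_i)\prod_{j=k+1}^{2k-1}g(\bar\alpha_j).$$ Then $$C^{-1}F_A(\beta;1,\dots,1,(-1)^kt)={}_kF_{k-1}\bigg(\begin{matrix}\alpha_1&\alpha_2&\dots&\alpha_k\\&\alpha_{k+1}&\dots&\alpha_{2k-1}\end{matrix}\;\bigg|\;t\bigg),$$ where on the left the first $2k-1$ coordinates of the argument $\lambda\in(\mathbb{F}_q^\times)^{2k}$ equal $1$ and the last equals $(-1)^kt$.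
   Context: $q=p^a$ with $p$ prime. $\widehat{\mathbb{F}_q^\times}$ is the group of multiplicative characters $\chi:\mathbb{F}_q^\times\to\mathbb{C}^\times$, and $\bar\chi$ denotes the complex conjugate (equivalently, inverse) of $\chi$. For $\chi\in\widehat{\mathbb{F}_q^\times}$ the Gauss sum is $g(\chi)=\sum_{x\in\mathbb{F}_q^\times}\chi(x)\Psi(x)\in\mathbb{C}$. For $\chi\in\widehat{\mathbb{F}_q^\times}$ and $\mathbf{b}=(b_1,\dots,b_n)\in(\mathbb{Z}/(q-1)\mathbb{Z})^n$, put $\chi^{\mathbf{b}}=(\chi^{b_1},\dots,\chi^{b_n})\in(\widehat{\mathbb{F}_q^\times})^n$. Products in $(\widehat{\mathbb{F}_q^\times})^n$ are componentwise. Given $A=\{\mathbf{a}_1,\dots,\mathbf{a}_N\}$ in $(\mathbb{Z}/(q-1)\mathbb{Z})^n$ (treated as an indexed list) and $\beta\in(\widehat{\mathbb{F}_q^\times})^n$, define $$L_\beta=\Big\{\chi=(\chi_1,\dots,\chi_N)\in(\widehat{\mathbb{F}_q^\times})^N \;\Big|\; \prod_{i=1}^N\chi_i^{\mathbf{a}_i}=\beta\Big\}.$$ The finite field $A$-hypergeometric function is, for $\lambda=(\lambda_1,\dots,\lambda_N)\in(\mathbb{F}_q^\times)^N$, $$F_A(\beta;\lambda)=(q-1)^{n-N}\sum_{\chi\in L_\beta}g(\bar\chi_1)\cdots g(\bar\chi_N)\,\chi_1(\lambda_1)\cdots\chi_N(\lambda_N).$$ McCarthy's finite field hypergeometric function is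 defined by $${}_kF_{k-1}\bigg(\begin{matrix}\alpha_1&\alpha_2&\dots&\alpha_k\\&\alpha_{k+1}&\dots&\alpha_{2k-1}\end{matrix}\;\bigg|\;t\bigg)=\frac{1}{q-1}\sum_{\chi\in\widehat{\mathbb{F}_q^\times}}\bigg(\prod_{i=1}^k\frac{g(\alpha_i\chi)}{g(\alpha_i)}\prod_{j=k+1}^{2k-1}\frac{g(\bar\alpha_j\bar\chi)}{g(\bar\alpha_j)}\bigg)g(\bar\chi)\,\chi((-1)^kt).$$ *)

theory Defs
  imports Complex_Main "HOL-Library.FuncSet" "HOL-Library.Cardinality" "HOL-Computational_Algebra.Primes"
begin

text \<open>
  A homomorphism from the nonzero elements of the field to the nonzero complex numbers is
  represented by its extension by \<open>0\<close> to the whole type.  The extension only makes the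
  representing function unique: Gauss sums run over nonzero elements, and the hypergeometric
  functions below are meant for nonzero arguments only.
\<close>

typedef (overloaded) ('a::finite_field) mchar =
  "{f :: 'a \<Rightarrow> complex. f 0 = 0 \<and> (\<forall>x. x \<noteq> 0 \<longrightarrow> f x \<noteq> 0) \<and>
     (\<forall>x y. x \<noteq> 0 \<longrightarrow> y \<noteq> 0 \<longrightarrow> f (x * y) = f x * f y)}"
  morphisms mc Abs_mchar
  by (intro exI[of _ "\<lambda>x. if x = 0 then 0 else 1"]) auto

setup_lifting type_definition_mchar

lemma mchar_eqI: "(\<And>x. x \<noteq> 0 \<Longrightarrow> mc \<chi> x = mc \<psi> x) \<Longrightarrow> \<chi> = \<psi>"
  by transfer (metis ext)

instantiation mchar :: (finite_field) "{comm_monoid_mult, inverse}"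
begin

lift_definition one_mchar :: "'a mchar" is "\<lambda>x. if x = 0 then 0 else 1"
  by auto

lift_definition times_mchar :: "'a mchar \<Rightarrow> 'a mchar \<Rightarrow> 'a mchar" is "\<lambda>f g x. f x * g x"
  by auto

lift_definition inverse_mchar :: "'a mchar \<Rightarrow> 'a mchar" is "\<lambda>f x. inverse (f x)"
  by auto

definition divide_mchar :: "'a mchar \<Rightarrow> 'a mchar \<Rightarrow> 'a mchar" where
  "divide_mchar \<chi> \<psi> = \<chi> * inverse \<psi>"

instance
  by standard (transfer; fastforce simp: mult_ac)+

end

lift_definition mchar_cnj :: "('a::finite_field) mchar \<Rightarrow> 'a mchar" is "\<lambda>f x. cnj (f x)"
  by auto

lemma mc_mult: "mc (\<chi> * \<psi>) x = mc \<chi> x * mc \<psi> x"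
  by transfer simp

lemma mc_one: "x \<noteq> 0 \<Longrightarrow> mc 1 x = 1"
  by transfer simp

lemma mc_inverse: "mc (inverse \<chi>) x = inverse (mc \<chi> x)"
  by transfer simp

lemma mc_cnj: "mc (mchar_cnj \<chi>) x = cnj (mc \<chi> x)"
  by transfer simp

lemma mc_0: "mc \<chi> 0 = 0"
  by transfer simp

lemma mc_nonzero: "x \<noteq> 0 \<Longrightarrow> mc \<chi> x \<noteq> 0"
  by transfer simp

lemma mc_hom: "x \<noteq> 0 \<Longrightarrow> y \<noteq> 0 \<Longrightarrow> mc \<chi> (x * y) = mc \<chi> x * mc \<chi> y"
  by transfer simp

lemma mc_at_1: "mc \<chi> 1 = 1"
  using mc_hom[of 1 1 \<chi>] mc_nonzero[of 1 \<chi>] by simp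

lemma mc_power: "x \<noteq> 0 \<Longrightarrow> mc (\<chi> ^ m) x = mc \<chi> x ^ m"
  by (induction m) (simp_all add: mc_one mc_mult)

lemma mc_at_power: "x \<noteq> 0 \<Longrightarrow> mc \<chi> (x ^ m) = mc \<chi> x ^ m"
  by (induction m) (simp_all add: mc_at_1 mc_hom)

lemma mc_powi: "x \<noteq> 0 \<Longrightarrow> mc (\<chi> powi b) x = mc \<chi> x powi b"
  by (simp add: power_int_def mc_power mc_inverse)

lemma mchar_inverse_right: "\<chi> * inverse \<chi> = (1 :: ('a::finite_field) mchar)"
  by (rule mchar_eqI) (simp add: mc_mult mc_inverse mc_one mc_nonzero)

lemma card_finite_field_gt_1: "card (UNIV :: ('a::finite_field) set) > 1"
  using card_mono[of "UNIV :: 'a set" "{0, 1}"] by simp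

lemma mc_root_of_unity:
  fixes \<chi> :: "('a::finite_field) mchar"
  assumes "x \<noteq> 0"
  shows "mc \<chi> x ^ (CARD('a) - 1) = 1"
proof -
  have "x * x ^ (CARD('a) - 1) = x ^ CARD('a)"
    using card_finite_field_gt_1[where ?'a = 'a]
    by (metis One_nat_def Suc_diff_1 less_trans zero_less_one power_Suc)
  also have "\<dots> = x * 1"
    by (simp add: finite_field_power_card_eq_same)
  finally have "x ^ (CARD('a) - 1) = 1"
    using assms by simp
  then show ?thesis
    using mc_at_power[OF assms, of \<chi> "CARD('a) - 1"] by (simp add: mc_at_1)
qed

lemma mchar_cnj_eq_inverse: "mchar_cnj \<chi> = inverse (\<chi> :: ('a::finite_field) mchar)"
proof (rule mchar_eqI)
  fix x :: 'a
  assume x: "x \<noteq> 0"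
  have "norm (mc \<chi> x) ^ (CARD('a) - 1) = 1"
    using mc_root_of_unity[OF x, of \<chi>] by (metis norm_one norm_power)
  then have "norm (mc \<chi> x) = 1"
    using card_finite_field_gt_1[where ?'a = 'a]
    by - (rule power_eq_imp_eq_base[of _ "CARD('a) - 1"]; simp)
  then have "mc \<chi> x * cnj (mc \<chi> x) = 1"
    using complex_norm_square[of "mc \<chi> x"] by simp
  then show "mc (mchar_cnj \<chi>) x = mc (inverse \<chi>) x"
    by (metis mc_cnj mc_inverse inverse_unique)
qed

instance mchar :: (finite_field) finite
proof
  let ?R = "insert 0 {z :: complex. z ^ (CARD('a) - 1) = 1}"
  have "CARD('a) - 1 \<ge> 1"
    using card_finite_field_gt_1[where ?'a = 'a] by linarith
  then have "finite ?R"
    by (intro finite.insertI finite_roots_unity)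
  then have "finite (PiE (UNIV :: 'a set) (\<lambda>_. ?R))"
    by (intro finite_PiE) auto
  moreover have "mc \<chi> x \<in> ?R" for \<chi> :: "'a mchar" and x
    using mc_root_of_unity[of x \<chi>] mc_0[of \<chi>] by (cases "x = 0") simp_all
  then have "range mc \<subseteq> PiE (UNIV :: 'a set) (\<lambda>_. ?R)"
    by (intro image_subsetI PiE_I) (simp_all only: UNIV_I not_True_eq_False)
  ultimately have "finite (range (mc :: 'a mchar \<Rightarrow> _))"
    by (rule rev_finite_subset)
  then show "finite (UNIV :: 'a mchar set)"
    by (rule finite_imageD) (simp add: mc_inject inj_def)
qed

text \<open>
  Elements of \<open>\<int>/(q-1)\<int>\<close> are represented by integers and act on characters through
  \<^const>\<open>power_int\<close>.  The following fact shows that this depends only on the residue class.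
\<close>

lemma mchar_powi_mod:
  fixes \<chi> :: "('a::finite_field) mchar"
  assumes "b mod (int CARD('a) - 1) = c mod (int CARD('a) - 1)"
  shows "\<chi> powi b = \<chi> powi c"
proof (rule mchar_eqI)
  fix x :: 'a
  assume x: "x \<noteq> 0"
  obtain d where d: "b = c + (int CARD('a) - 1) * d"
  proof -
    from assms have "int CARD('a) - 1 dvd b - c"
      by (rule iffD1[OF mod_eq_dvd_iff])
    then obtain d where "b - c = (int CARD('a) - 1) * d" ..
    then show thesis
      by (intro that[of d]) (simp only: diff_eq_eq add.commute)
  qed
  have q: "int CARD('a) - 1 = int (CARD('a) - 1)"
    using card_finite_field_gt_1[where ?'a = 'a] by simp
  have "mc \<chi> x powi ((int CARD('a) - 1) * d) = 1"
    using mc_root_of_unity[OF x, of \<chi>] by (simp only: q power_int_mult power_int_of_nat power_int_1_left)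
  then show "mc (\<chi> powi b) x = mc (\<chi> powi c) x"
    using x by (simp add: mc_powi d power_int_add mc_nonzero)
qed

definition additive_character :: "(('a::finite_field) \<Rightarrow> complex) \<Rightarrow> bool" where
  "additive_character \<Psi> \<longleftrightarrow>
     (\<forall>x. \<Psi> x \<noteq> 0) \<and> (\<forall>x y. \<Psi> (x + y) = \<Psi> x * \<Psi> y)"

definition nontrivial_additive_character :: "(('a::finite_field) \<Rightarrow> complex) \<Rightarrow> bool" where
  "nontrivial_additive_character \<Psi> \<longleftrightarrow> additive_character \<Psi> \<and> (\<exists>x. \<Psi> x \<noteq> 1)"

definition gauss_sum :: "(('a::finite_field) \<Rightarrow> complex) \<Rightarrow> 'a mchar \<Rightarrow> complex" where
  "gauss_sum \<Psi> \<chi> = (\<Sum>x\<in>UNIV - {0}. mc \<chi> x * \<Psi> x)"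

text \<open>
  Vectors of length \<open>m\<close> are functions on \<open>{1..m}\<close>; the list \<open>A\<close> is given by \<open>a i j\<close>, the
  \<open>j\<close>-th coordinate of its \<open>i\<close>-th element (\<open>1 \<le> i \<le> N\<close>, \<open>1 \<le> j \<le> n\<close>).  The index tuples
  \<open>\<chi>\<close> are taken extensional on \<open>{1..N}\<close>, so that each of them is counted exactly once.
\<close>

definition L_set ::
  "nat \<Rightarrow> nat \<Rightarrow> (nat \<Rightarrow> nat \<Rightarrow> int) \<Rightarrow> (nat \<Rightarrow> ('a::finite_field) mchar) \<Rightarrow> (nat \<Rightarrow> 'a mchar) set"
  where
  "L_set n N a \<beta> =
     {\<chi> \<in> {1..N} \<rightarrow>\<^sub>E UNIV. \<forall>j\<in>{1..n}. (\<Prod>i = 1..N. \<chi> i powi a i j) = \<beta> j}"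

definition F_A ::
  "(('a::finite_field) \<Rightarrow> complex) \<Rightarrow> nat \<Rightarrow> nat \<Rightarrow> (nat \<Rightarrow> nat \<Rightarrow> int) \<Rightarrow>
     (nat \<Rightarrow> 'a mchar) \<Rightarrow> (nat \<Rightarrow> 'a) \<Rightarrow> complex"
  where
  "F_A \<Psi> n N a \<beta> l =
     (of_nat CARD('a) - 1) powi (int n - int N) *
     (\<Sum>\<chi>\<in>L_set n N a \<beta>.
        (\<Prod>i = 1..N. gauss_sum \<Psi> (mchar_cnj (\<chi> i))) * (\<Prod>i = 1..N. mc (\<chi> i) (l i)))"

lemma F_A_mod:
  fixes \<Psi> :: "('a::finite_field) \<Rightarrow> complex"
  assumes "\<And>i j. i \<in> {1..N} \<Longrightarrow> j \<in> {1..n} \<Longrightarrow>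
    a i j mod (int CARD('a) - 1) = a' i j mod (int CARD('a) - 1)"
  shows "F_A \<Psi> n N a \<beta> l = F_A \<Psi> n N a' \<beta> l"
proof -
  have "(\<Prod>i = 1..N. \<chi> i powi a i j) = (\<Prod>i = 1..N. \<chi> i powi a' i j)"
    if "j \<in> {1..n}" for j and \<chi> :: "nat \<Rightarrow> 'a mchar"
    using that by (intro prod.cong refl mchar_powi_mod assms)
  then have "L_set n N a \<beta> = L_set n N a' \<beta>"
    by (auto simp: L_set_def)
  then show ?thesis
    by (simp add: F_A_def)
qed

definition mccarthy_F ::
  "(('a::finite_field) \<Rightarrow> complex) \<Rightarrow> nat \<Rightarrow> (nat \<Rightarrow> 'a mchar) \<Rightarrow> 'a \<Rightarrow> complex"
  where
  "mccarthy_F \<Psi> k \<alpha> t =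
     1 / (of_nat CARD('a) - 1) *
     (\<Sum>\<chi>\<in>UNIV.
        (\<Prod>i = 1..k. gauss_sum \<Psi> (\<alpha> i * \<chi>) / gauss_sum \<Psi> (\<alpha> i)) *
        (\<Prod>j = k+1..2*k-1. gauss_sum \<Psi> (mchar_cnj (\<alpha> j) * mchar_cnj \<chi>) / gauss_sum \<Psi> (mchar_cnj (\<alpha> j))) *
        gauss_sum \<Psi> (mchar_cnj \<chi>) * mc \<chi> ((-1) ^ k * t))"

end

(* The equations defining L_beta determine all coordinates of a tuple from the last one, chi:
   the i-th is (alpha_i chi)^-1 for i <= k and alpha_i chi for k < i < 2k.  So L_beta is
   parametrized by chi, and the two sums agree term by term. *)

theory Submission
  imports Defs
begin

lemma mchar_inverse_mult:
  fixes x y :: "('a::finite_field) mchar"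
  shows "inverse (x * y) = inverse x * inverse y"
  by (rule mchar_eqI) (simp add: mc_mult mc_inverse)

lemma mchar_inverse_inverse: "inverse (inverse (x :: ('a::finite_field) mchar)) = x"
  by (rule mchar_eqI) (simp add: mc_inverse)

text \<open>Cancellation by the group law \<open>mchar_inverse_right\<close>. It serves to solve
  each defining equation of \<open>L_set\<close> for a single coordinate.\<close>

lemma mchar_mult_eq_iff:
  fixes x y z :: "('a::finite_field) mchar"
  shows "x * y = z \<longleftrightarrow> x = z * inverse y"
proof
  assume "x * y = z"
  then have "z * inverse y = x * (y * inverse y)"
    by (simp flip: mult.assoc)
  then show "x = z * inverse y"
    by (simp add: mchar_inverse_right)
next
  assume "x = z * inverse y"
  then have "x * y = z * (y * inverse y)"
    by (simp add: mult_ac)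
  then show "x * y = z"
    by (simp add: mchar_inverse_right)
qed

lemma mchar_powi_simps:
  fixes x :: "('a::finite_field) mchar"
  shows "x powi 0 = 1" "x powi 1 = x" "x powi (- 1) = inverse x"
  by (simp_all add: power_int_def)

lemma prod_atLeast1_double:
  fixes f :: "nat \<Rightarrow> 'b::comm_monoid_mult"
  assumes "k \<ge> 1"
  \<comment> \<open>At \<open>k = 0\<close> the right side would carry a stray factor
    \<open>f 0\<close>, hence the assumption.\<close>
  shows "(\<Prod>i = 1..2*k. f i) = (\<Prod>i = 1..2*k-1. f i) * f (2*k)"
proof -
  have "{1..2*k} = insert (2*k) {1..2*k-1}"
    using assms by auto
  then show ?thesis
    using assms by (simp add: mult.commute)
qed

lemma prod_atLeast1_split:
  fixes f :: "nat \<Rightarrow> 'b::comm_monoid_mult"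
  assumes "k \<ge> 1"
  shows "(\<Prod>i = 1..2*k-1. f i) = (\<Prod>i = 1..k. f i) * (\<Prod>i = k+1..2*k-1. f i)"
proof -
  have "{1..2*k-1} = {1..k} \<union> {k+1..2*k-1}"
    using assms by auto
  then show ?thesis
    by (simp add: prod.union_disjoint)
qed

text \<open>The restriction to \<open>{1..2*k}\<close> makes the tuple extensional, as membership in
  \<open>L_set\<close> demands.\<close>

definition mccarthy_tuple ::
  "nat \<Rightarrow> (nat \<Rightarrow> ('a::finite_field) mchar) \<Rightarrow> 'a mchar \<Rightarrow> nat \<Rightarrow> 'a mchar" where
  "mccarthy_tuple k \<alpha> \<chi> = (\<lambda>i\<in>{1..2*k}.
     if i \<le> k then inverse (\<alpha> i * \<chi>) else if i < 2*k then \<alpha> i * \<chi> else \<chi>)"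

text \<open>Among the first \<open>2*k-1\<close> vectors only the \<open>j\<close>-th has a nonzero
  \<open>j\<close>-th coordinate, so equation \<open>j\<close> involves just \<open>c j\<close> and
  \<open>c (2*k)\<close>. It has a unique solution for \<open>c j\<close>, and nothing constrains
  \<open>c (2*k)\<close>.\<close>

lemma L_set_mccarthy:
  fixes \<alpha> \<beta> :: "nat \<Rightarrow> ('a::finite_field) mchar"
  assumes k: "k \<ge> 1"
    and unit: "\<And>i j. i \<in> {1..2*k-1} \<Longrightarrow> j \<in> {1..2*k-1} \<Longrightarrow> a i j = (if i = j then 1 else 0)"
    and low: "\<And>j. j \<in> {1..k} \<Longrightarrow> a (2*k) j = 1"
    and high: "\<And>j. j \<in> {k+1..2*k-1} \<Longrightarrow> a (2*k) j = -1"
    and \<beta>_low: "\<And>j. j \<in> {1..k} \<Longrightarrow> \<beta> j = mchar_cnj (\<alpha> j)"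
    and \<beta>_high: "\<And>j. j \<in> {k+1..2*k-1} \<Longrightarrow> \<beta> j = \<alpha> j"
  shows "L_set (2*k-1) (2*k) a \<beta> = range (mccarthy_tuple k \<alpha>)"
proof -
  \<comment> \<open>As an equivalence for arbitrary \<open>c\<close>, this yields both inclusions
    below.\<close>
  have eqn: "(\<Prod>i = 1..2*k. c i powi a i j) = \<beta> j \<longleftrightarrow>
      c j = (if j \<le> k then inverse (\<alpha> j * c (2*k)) else \<alpha> j * c (2*k))"
    if j: "j \<in> {1..2*k-1}" for c j
  proof -
    have "(\<Prod>i = 1..2*k-1. c i powi a i j) = (\<Prod>i = 1..2*k-1. if i = j then c i else 1)"
      using j by (intro prod.cong) (auto simp: unit mchar_powi_simps)
    also have "\<dots> = c j"
      using j by simp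
    finally have "(\<Prod>i = 1..2*k. c i powi a i j) = c j * c (2*k) powi a (2*k) j"
      by (simp only: prod_atLeast1_double[OF k])
    moreover have "c j * c (2*k) powi a (2*k) j = \<beta> j \<longleftrightarrow>
      c j = (if j \<le> k then inverse (\<alpha> j * c (2*k)) else \<alpha> j * c (2*k))"
    proof (cases "j \<le> k")
      case True
      then show ?thesis
        using j low[of j] \<beta>_low[of j]
        by (simp add: mchar_powi_simps mchar_mult_eq_iff[of "c j"] mchar_inverse_mult mchar_cnj_eq_inverse)
    next
      case False
      then show ?thesis
        using j high[of j] \<beta>_high[of j]
        by (simp add: mchar_powi_simps mchar_mult_eq_iff[of "c j"] mchar_inverse_inverse)
    qed
    ultimately show ?thesis
      by simp
  qed
  show ?thesis
  proof (intro equalityI subsetI)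
    fix c
    assume "c \<in> L_set (2*k-1) (2*k) a \<beta>"
    then have ext: "c \<in> {1..2*k} \<rightarrow>\<^sub>E UNIV"
      and c: "\<And>j. j \<in> {1..2*k-1} \<Longrightarrow>
        c j = (if j \<le> k then inverse (\<alpha> j * c (2*k)) else \<alpha> j * c (2*k))"
      using eqn by (auto simp: L_set_def)
    have "c i = mccarthy_tuple k \<alpha> (c (2*k)) i" for i
    proof -
      consider "i \<in> {1..2*k-1}" | "i = 2*k" | "i \<notin> {1..2*k}"
        by fastforce
      then show ?thesis
      proof cases
        case 1
        then show ?thesis
          using c[OF 1] by (auto simp: mccarthy_tuple_def)
      next
        case 2
        then show ?thesis
          using k by (simp add: mccarthy_tuple_def)
      next
        \<comment> \<open>Outside the index range both sides are \<open>undefined\<close>.\<close>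
        case 3
        then show ?thesis
          using PiE_arb[OF ext 3] by (auto simp: mccarthy_tuple_def)
      qed
    qed
    then show "c \<in> range (mccarthy_tuple k \<alpha>)"
      by blast
  next
    fix c
    assume "c \<in> range (mccarthy_tuple k \<alpha>)"
    then obtain \<chi> where c: "c = mccarthy_tuple k \<alpha> \<chi>"
      by blast
    have "(\<Prod>i = 1..2*k. c i powi a i j) = \<beta> j" if j: "j \<in> {1..2*k-1}" for j
      unfolding eqn[OF j] using j k by (auto simp: c mccarthy_tuple_def)
    then show "c \<in> L_set (2*k-1) (2*k) a \<beta>"
      by (simp add: L_set_def c mccarthy_tuple_def)
  qed
qed

text \<open>The parameter is recovered as the last coordinate. This permits reindexing the sum over
  \<open>L_set\<close> by all characters.\<close>

lemma inj_mccarthy_tuple: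
  assumes "k \<ge> 1"
  shows "inj (mccarthy_tuple k \<alpha>)"
proof (rule injI)
  fix \<chi> \<psi>
  assume "mccarthy_tuple k \<alpha> \<chi> = mccarthy_tuple k \<alpha> \<psi>"
  then have "mccarthy_tuple k \<alpha> \<chi> (2*k) = mccarthy_tuple k \<alpha> \<psi> (2*k)"
    by simp
  then show "\<chi> = \<psi>"
    using assms by (simp add: mccarthy_tuple_def)
qed

theorem mainTheorem2:
  fixes \<Psi> :: "'a::finite_field \<Rightarrow> complex"
    and k :: nat
    and \<alpha> :: "nat \<Rightarrow> 'a mchar"
    and t :: 'a
    and a :: "nat \<Rightarrow> nat \<Rightarrow> int"
    and \<beta> :: "nat \<Rightarrow> 'a mchar"
    and l :: "nat \<Rightarrow> 'a"
    and C :: complex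
  assumes "nontrivial_additive_character \<Psi>"
    and "k \<ge> 1"
    and "t \<noteq> 0"
    and "\<And>i j. i \<in> {1..2*k-1} \<Longrightarrow> j \<in> {1..2*k-1} \<Longrightarrow> a i j = (if i = j then 1 else 0)"
    and "\<And>j. j \<in> {1..k} \<Longrightarrow> a (2*k) j = 1"
    and "\<And>j. j \<in> {k+1..2*k-1} \<Longrightarrow> a (2*k) j = -1"
    and "\<And>j. j \<in> {1..k} \<Longrightarrow> \<beta> j = mchar_cnj (\<alpha> j)"
    and "\<And>j. j \<in> {k+1..2*k-1} \<Longrightarrow> \<beta> j = \<alpha> j"
    and "\<And>i. i \<in> {1..2*k-1} \<Longrightarrow> l i = 1"
    and "l (2*k) = (-1) ^ k * t"
    and "C = (\<Prod>i = 1..k. gauss_sum \<Psi> (\<alpha> i)) *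
             (\<Prod>j = k+1..2*k-1. gauss_sum \<Psi> (mchar_cnj (\<alpha> j)))"
  shows "inverse C * F_A \<Psi> (2*k-1) (2*k) a \<beta> l = mccarthy_F \<Psi> k \<alpha> t"
proof -
  note k = assms(2) and l_one = assms(9) and l_last = assms(10) and C = assms(11)
  let ?T = "mccarthy_tuple k \<alpha>"
  let ?G = "\<lambda>\<chi>. (\<Prod>i = 1..k. gauss_sum \<Psi> (\<alpha> i * \<chi>)) *
    (\<Prod>j = k+1..2*k-1. gauss_sum \<Psi> (mchar_cnj (\<alpha> j) * mchar_cnj \<chi>)) *
    gauss_sum \<Psi> (mchar_cnj \<chi>)"
  have T_last: "?T \<chi> (2*k) = \<chi>" for \<chi>
    using k by (simp add: mccarthy_tuple_def)
  \<comment> \<open>Conjugation is inversion: it cancels the inverse in the coordinates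
    \<open>i \<le> k\<close> and inverts \<open>\<alpha> i * \<chi>\<close> in the later ones, which
    gives McCarthy's numerators.\<close>
  have gauss: "(\<Prod>i = 1..2*k. gauss_sum \<Psi> (mchar_cnj (?T \<chi> i))) = ?G \<chi>" for \<chi>
    unfolding prod_atLeast1_double[OF k] prod_atLeast1_split[OF k] T_last
    by (intro arg_cong2[of _ _ _ _ "(*)"] prod.cong refl)
      (auto simp: mccarthy_tuple_def mchar_cnj_eq_inverse mchar_inverse_inverse mchar_inverse_mult)
  \<comment> \<open>Every character is 1 at 1, so only the last argument contributes.\<close>
  have args: "(\<Prod>i = 1..2*k. mc (?T \<chi> i) (l i)) = mc \<chi> ((-1) ^ k * t)" for \<chi>
    unfolding prod_atLeast1_double[OF k] T_last l_last by (simp add: l_one mc_at_1)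
  \<comment> \<open>The power of q-1 in \<open>F_A\<close> thus becomes McCarthy's factor 1/(q-1);
    \<open>k \<ge> 1\<close> prevents truncation in \<open>2*k-1\<close>.\<close>
  have exponent: "int (2*k-1) - int (2*k) = -1"
    using k by simp
  have L: "L_set (2*k-1) (2*k) a \<beta> = range ?T"
    by (rule L_set_mccarthy) (fact assms)+
  have F: "F_A \<Psi> (2*k-1) (2*k) a \<beta> l =
      1 / (of_nat CARD('a) - 1) * (\<Sum>\<chi>\<in>UNIV. ?G \<chi> * mc \<chi> ((-1) ^ k * t))"
    unfolding F_A_def L exponent
      sum.reindex[OF inj_mccarthy_tuple[OF k]] o_def gauss args power_int_minus
    by (simp only: power_int_1_right inverse_eq_divide)
  have summand: "inverse C * (?G \<chi> * z) =
      (\<Prod>i = 1..k. gauss_sum \<Psi> (\<alpha> i * \<chi>) / gauss_sum \<Psi> (\<alpha> i)) *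
      (\<Prod>j = k+1..2*k-1. gauss_sum \<Psi> (mchar_cnj (\<alpha> j) * mchar_cnj \<chi>) /
        gauss_sum \<Psi> (mchar_cnj (\<alpha> j))) * gauss_sum \<Psi> (mchar_cnj \<chi>) * z" for \<chi> z
    \<comment> \<open>valid without \<open>C \<noteq> 0\<close>, since \<open>inverse\<close> stays multiplicative with \<open>inverse 0 = 0\<close>\<close>
    unfolding C prod_dividef by (simp only: divide_inverse inverse_mult_distrib mult_ac)
  show ?thesis
    \<comment> \<open>Using \<open>summand\<close> backwards pulls \<open>inverse C\<close> out of
      McCarthy's sum; only the order of the two scalar factors then differs.\<close>
    unfolding F mccarthy_F_def summand[symmetric] sum_distrib_left[symmetric]
    by (rule mult.left_commute)
qed

end
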